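(* Let $s\ge1$ be an integer and let $S\subseteq\{0,1,\dots,s\}$ with $0\in S$. Let $\alpha$ be the minimum of $w(\gamma)/|\gamma|$ over all cycles $\gamma$ in the weighted directed graph $G_S$ defined below. Then $\tau(S)=\alpha$, and there is a periodic set $T\subseteq\mathbb Z$ with $T+S=\mathbb Z$ whose density equals $\tau(S)$. In particular, $\tau(S)$ is rational.
   Context: For a finite non-empty $S\subset\mathbb Z$ and $n\ge1$, $\tau(S,n)=\min\{|T|:T\subseteq\mathbb Z,\ T+S\supseteq\{1,\dots,n\}\}$, and the covering density is $\tau(S)=\lim_{n\to\infty}\tau(S,n)/n$ (the limit exists and equals $\inf_{n\ge1}\tau(S,n)/n$). A set $T\subseteq\mathbb Z$ is periodic with period $\ell\ge1$ if $T+\ell=T$; its density is then $|T\cap\{0,\dots,\ell-1\}|/\ell$. The graph $G_S$: the vertex set is the power set of $\{1,\dots,s\}$; for a vertex $A$ write $A-1=\{a-1:a\in A\}$. There is a directed edge of weight $0$ from $A$ to $B$ if and only if $s+1\in A+S$ and $B=(A-1)\setminus\{0\}$, and a directed edge of weight $1$ from $A$ to $B$ if $B=((A-1)\setminus\{0\})\cup\{s\}$. A cycle is a directed closed walk $v_0v_1\cdots v_{m-1}v_0$ with $v_0,\dots,v_{m-1}$ distinct; $|\gamma|$ is its number of edges and $w(\gamma)$ the sum of its edge weights. *)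

theory Defs
  imports Complex_Main "HOL-Library.Set_Algebras" "Graph_Theory.Weighted_Graph"
begin

section \<open>Covering density\<close>

text \<open>The requirement that \<open>T\<close> be finite is explicit because \<open>card\<close> is \<open>0\<close> on infinite sets.\<close>

definition cover_num :: "int set \<Rightarrow> nat \<Rightarrow> nat" where
  "cover_num S n = (LEAST k. \<exists>T. finite T \<and> card T = k \<and> {1..int n} \<subseteq> T + S)"

definition cover_density :: "int set \<Rightarrow> real" where
  "cover_density S = lim (\<lambda>n. real (cover_num S n) / real n)"

lemma cover_num_attained:
  assumes "S \<noteq> {}"
  shows "\<exists>T. finite T \<and> card T = cover_num S n \<and> {1..int n} \<subseteq> T + S"
proof -
  obtain x where x: "x \<in> S" using assms by blast
  have "{1..int n} \<subseteq> (\<lambda>i. i - x) ` {1..int n} + S"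
  proof
    fix i assume "i \<in> {1..int n}"
    then have "(i - x) + x \<in> (\<lambda>i. i - x) ` {1..int n} + S"
      using x by (intro set_plus_intro) auto
    then show "i \<in> (\<lambda>i. i - x) ` {1..int n} + S" by simp
  qed
  then have "\<exists>k. \<exists>T. finite T \<and> card T = k \<and> {1..int n} \<subseteq> T + S"
    by (intro exI[of _ "card ((\<lambda>i. i - x) ` {1..int n})"] exI[of _ "(\<lambda>i. i - x) ` {1..int n}"])
       auto
  then show ?thesis unfolding cover_num_def by (rule LeastI_ex)
qed

lemma cover_num_le:
  assumes "finite T" "{1..int n} \<subseteq> T + S"
  shows "cover_num S n \<le> card T"
  unfolding cover_num_def using assms by (intro Least_le) blast

lemma cover_num_subadditive:
  assumes "S \<noteq> {}"
  shows "cover_num S (m + n) \<le> cover_num S m + cover_num S n"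
proof -
  obtain T where T: "finite T" "card T = cover_num S m" "{1..int m} \<subseteq> T + S"
    using cover_num_attained[OF assms] by blast
  obtain U where U: "finite U" "card U = cover_num S n" "{1..int n} \<subseteq> U + S"
    using cover_num_attained[OF assms] by blast
  let ?U = "(+) (int m) ` U"
  have "{1..int (m + n)} \<subseteq> (T \<union> ?U) + S"
  proof
    fix i assume i: "i \<in> {1..int (m + n)}"
    show "i \<in> (T \<union> ?U) + S"
    proof (cases "i \<le> int m")
      case True
      then have "i \<in> T + S" using i T(3) by auto
      then show ?thesis by (auto simp: set_plus_def)
    next
      case False
      then have "i - int m \<in> {1..int n}" using i by auto
      then have "i - int m \<in> U + S" using U(3) by blast
      then obtain u x where "u \<in> U" "x \<in> S" "i - int m = u + x" by (auto simp: set_plus_def)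
      then have "i = (int m + u) + x" "int m + u \<in> T \<union> ?U" "x \<in> S" by auto
      then show ?thesis by (metis set_plus_intro)
    qed
  qed
  then have "cover_num S (m + n) \<le> card (T \<union> ?U)" using T(1) U(1) by (intro cover_num_le) auto
  also have "\<dots> \<le> card T + card ?U" by (rule card_Un_le)
  also have "card ?U \<le> card U" using U(1) by (rule card_image_le)
  finally show ?thesis using T(2) U(2) by simp
qed

lemma subadditive_LIMSEQ:
  fixes a :: "nat \<Rightarrow> real"
  assumes nonneg: "\<And>n. 0 \<le> a n" and sub: "\<And>m n. a (m + n) \<le> a m + a n"
  shows "(\<lambda>n. a n / real n) \<longlonglongrightarrow> (INF n\<in>{1..}. a n / real n)"
proof -
  define L where "L = (INF n\<in>{1..}. a n / real n)"
  have bdd: "bdd_below ((\<lambda>n. a n / real n) ` {1..})"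
    using nonneg by (intro bdd_belowI2[where m = 0]) auto
  have mult: "a (q * k + r) \<le> real q * a k + a r" for q k r
  proof (induction q)
    case (Suc q)
    have "a (Suc q * k + r) = a (k + (q * k + r))" by (simp add: algebra_simps)
    also have "\<dots> \<le> a k + a (q * k + r)" by (rule sub)
    finally show ?case using Suc by (simp add: algebra_simps)
  qed simp
  have "(\<lambda>n. a n / real n) \<longlonglongrightarrow> L"
  proof (rule LIMSEQ_I)
    fix e :: real assume e: "0 < e"
    have "L < L + e / 2" using e by simp
    then obtain k where k: "k \<ge> 1" "a k / real k < L + e / 2"
      unfolding L_def using bdd by (subst (asm) cINF_less_iff) auto
    define M where "M = Max (a ` {..<k})"
    have M: "a r \<le> M" if "r < k" for r
      unfolding M_def using that by (intro Max_ge) auto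
    have M0: "0 \<le> M" using M[of 0] nonneg[of 0] k(1) by linarith
    obtain N :: nat where N: "2 * M / e < real N" using reals_Archimedean2 by blast
    show "\<exists>no. \<forall>n\<ge>no. norm (a n / real n - L) < e"
    proof (intro exI[of _ "Suc N"] allI impI)
      fix n assume n: "Suc N \<le> n"
      then have n0: "0 < real n" by simp
      have lower: "L \<le> a n / real n"
        unfolding L_def using n by (intro cINF_lower[OF bdd]) auto
      have Mn: "M / real n < e / 2"
      proof -
        have "2 * M / e < real n" using N n by linarith
        then show ?thesis using e n0 by (simp add: field_simps)
      qed
      have "a n = a (n div k * k + n mod k)" by simp
      also have "\<dots> \<le> real (n div k) * a k + a (n mod k)" by (rule mult)
      also have "\<dots> \<le> real (n div k) * a k + M" using M[of "n mod k"] k(1) by simp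
      also have "real (n div k) * a k = real (n div k * k) * (a k / real k)"
        using k(1) by simp
      also have "\<dots> \<le> real n * (a k / real k)"
        using nonneg[of k] by (intro mult_right_mono) (auto simp del: of_nat_mult)
      finally have "a n / real n \<le> (real n * (a k / real k) + M) / real n"
        using n0 by (intro divide_right_mono) auto
      also have "\<dots> = a k / real k + M / real n" using n0 by (simp add: add_divide_distrib)
      finally have "a n / real n < L + e" using k(2) Mn by linarith
      then show "norm (a n / real n - L) < e" using lower by simp
    qed
  qed
  then show ?thesis by (simp add: L_def)
qed

lemma cover_density_LIMSEQ:
  assumes "S \<noteq> {}"
  shows "(\<lambda>n. real (cover_num S n) / real n) \<longlonglongrightarrow> cover_density S"
    and "cover_density S = (INF n\<in>{1..}. real (cover_num S n) / real n)"
proof -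
  have *: "(\<lambda>n. real (cover_num S n) / real n) \<longlonglongrightarrow> (INF n\<in>{1..}. real (cover_num S n) / real n)"
    using cover_num_subadditive[OF assms]
    by (intro subadditive_LIMSEQ) (auto simp flip: of_nat_add)
  then show eq: "cover_density S = (INF n\<in>{1..}. real (cover_num S n) / real n)"
    unfolding cover_density_def by (rule limI)
  show "(\<lambda>n. real (cover_num S n) / real n) \<longlonglongrightarrow> cover_density S"
    using * by (simp add: eq)
qed

section \<open>Periodic sets\<close>

definition has_period :: "int set \<Rightarrow> nat \<Rightarrow> bool" where
  "has_period T l \<longleftrightarrow> l \<ge> 1 \<and> T + {int l} = T"

definition period_density :: "int set \<Rightarrow> nat \<Rightarrow> real" where
  "period_density T l = real (card (T \<inter> {0..int l - 1})) / real l"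

section \<open>The weighted digraph\<close>

text \<open>An arc is a triple of its tail, its weight and its head.\<close>

type_synonym cover_arc = "int set \<times> nat \<times> int set"

definition shift :: "int set \<Rightarrow> int set" where
  "shift A = (\<lambda>a. a - 1) ` A"

definition cover_graph :: "nat \<Rightarrow> int set \<Rightarrow> (int set, cover_arc) pre_digraph" where
  "cover_graph s S =
    \<lparr> verts = Pow {1..int s},
      arcs = {(A, 0, B) | A B. A \<in> Pow {1..int s} \<and> int s + 1 \<in> A + S \<and> B = shift A - {0}}
           \<union> {(A, 1, B) | A B. A \<in> Pow {1..int s} \<and> B = (shift A - {0}) \<union> {int s}},
      tail = fst,
      head = (\<lambda>e. snd (snd e)) \<rparr>"

definition arc_weight :: "cover_arc \<Rightarrow> real" where
  "arc_weight e = real (fst (snd e))"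

definition cycle_means :: "nat \<Rightarrow> int set \<Rightarrow> real set" where
  "cycle_means s S =
    {wf_digraph.awalk_cost arc_weight c / real (length c) | c. pre_digraph.cycle (cover_graph s S) c}"

definition min_cycle_mean :: "nat \<Rightarrow> int set \<Rightarrow> real" where
  "min_cycle_mean s S = Min (cycle_means s S)"

lemma fin_digraph_cover_graph:
  assumes "s \<ge> 1"
  shows "fin_digraph (cover_graph s S)"
proof
  fix e assume e: "e \<in> arcs (cover_graph s S)"
  show "tail (cover_graph s S) e \<in> verts (cover_graph s S)"
    using e by (auto simp: cover_graph_def)
  show "head (cover_graph s S) e \<in> verts (cover_graph s S)"
    using e assms unfolding cover_graph_def shift_def by (auto simp: subset_iff) force+
next
  show "finite (verts (cover_graph s S))" by (simp add: cover_graph_def)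
next
  have "arcs (cover_graph s S) \<subseteq>
      (\<lambda>A. (A, 0, shift A - {0})) ` Pow {1..int s} \<union>
      (\<lambda>A. (A, 1, (shift A - {0}) \<union> {int s})) ` Pow {1..int s}"
    by (auto simp: cover_graph_def)
  then show "finite (arcs (cover_graph s S))"
    by (rule finite_subset) auto
qed

lemma finite_cycle_means:
  assumes "s \<ge> 1"
  shows "finite (cycle_means s S)"
proof -
  interpret fin_digraph "cover_graph s S" using assms by (rule fin_digraph_cover_graph)
  have "{c. cycle c} \<subseteq> {c. set c \<subseteq> arcs (cover_graph s S) \<and> distinct c}"
    by (auto simp: cycle_conv awalk_def)
  moreover have "finite {c. set c \<subseteq> arcs (cover_graph s S) \<and> distinct c}"
    by (rule finite_subset_distinct) simp
  ultimately have "finite {c. cycle c}" by (rule finite_subset)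
  moreover have "cycle_means s S = (\<lambda>c. awalk_cost arc_weight c / real (length c)) ` {c. cycle c}"
    by (auto simp: cycle_means_def)
  ultimately show ?thesis by simp
qed

lemma cycle_means_nonempty:
  assumes "s \<ge> 1"
  shows "cycle_means s S \<noteq> {}"
proof -
  interpret fin_digraph "cover_graph s S" using assms by (rule fin_digraph_cover_graph)
  let ?V = "{1..int s}"
  have "shift ?V = {0..int s - 1}"
    unfolding shift_def using image_add_atLeastAtMost[of "-1" 1 "int s"] by simp
  moreover have "({0..int s - 1} - {0}) \<union> {int s} = ?V"
    using assms by (intro set_eqI) (simp; linarith)
  ultimately have "(shift ?V - {0}) \<union> {int s} = ?V" by simp
  then have "(?V, 1, ?V) \<in> arcs (cover_graph s S)" by (simp add: cover_graph_def)
  moreover have "tail (cover_graph s S) (?V, 1, ?V) = ?V" "head (cover_graph s S) (?V, 1, ?V) = ?V"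
      "?V \<in> verts (cover_graph s S)"
    by (simp_all add: cover_graph_def)
  ultimately have "cycle [(?V, 1, ?V)]"
    unfolding cycle_def awalk_def by (intro exI[of _ ?V]) simp
  then show ?thesis by (auto simp: cycle_means_def)
qed

end

theory Submission
  imports Defs
begin

text \<open>
  Sliding a window of length \<open>s\<close> along a covering set \<open>T\<close> traces a walk in the graph: the arc
  leaving the window just before position \<open>x\<close> has weight \<open>1\<close> iff \<open>x \<in> T\<close>, and the condition on
  arcs of weight \<open>0\<close> says exactly that \<open>x\<close> is covered by earlier elements. A closed walk thus
  unrolls to a periodic covering set whose density is its mean weight, which bounds the covering
  density from above. Conversely, a cover of \<open>{1..n}\<close> gives a walk with \<open>n\<close> arcs; removing cycles
  until a path is left shows that its weight is at least \<open>\<alpha> (n - 2 ^ s)\<close>, and letting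
  \<open>n\<close> grow gives the lower bound.
\<close>

section \<open>Walks and cycle means\<close>

context wf_digraph
begin

lemma awalk_cost_nonneg:
  assumes "\<And>e. 0 \<le> f e"
  shows "0 \<le> awalk_cost f p"
  using assms by (induction p) auto

text \<open>A closed walk that is not a cycle splits into two shorter nonempty closed walks. Length
  and cost are both additive over this splitting, so a bound per arc is inherited by
  induction.\<close>

lemma closed_awalk_cost_ge:
  assumes cyc: "\<And>c. cycle c \<Longrightarrow> a * real (length c) \<le> awalk_cost f c"
    and "awalk u p u"
  shows "a * real (length p) \<le> awalk_cost f p"
  using assms(2)
proof (induction "length p" arbitrary: u p rule: less_induct)
  case less
  show ?case
  proof (cases p)
    case (Cons e es)
    show ?thesis
    proof (cases "distinct (tl (awalk_verts u p))")
      case True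
      then have "cycle p" using less.prems Cons unfolding cycle_def by blast
      then show ?thesis by (rule cyc)
    next
      case False
      \<comment> \<open>The first arc \<open>e\<close> is set aside and the repeated vertex is
        sought within \<open>es\<close>. This keeps the piece \<open>r\<close> cut out below from
        being all of \<open>p\<close>, so that both \<open>r\<close> and \<open>e # q @ t\<close>
        are shorter than \<open>p\<close>.\<close>
      have es: "awalk (head G e) es u" "\<not> distinct (awalk_verts (head G e) es)"
        using False less.prems Cons by (auto simp: awalk_Cons_iff)
      obtain q r t w where d: "es = q @ r @ t" "awalk (head G e) q w" "awalk w r w" "awalk w t u"
          "closed_w r"
        using awalk_cyc_decompE'[OF es] by metis
      have r: "0 < length r" using d(5) by (auto simp: closed_w_def)
      have "awalk u (e # q @ t) u"
        using d less.prems Cons by (auto simp: awalk_Cons_iff)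
      then have "a * real (length (e # q @ t)) \<le> awalk_cost f (e # q @ t)"
        using r Cons d(1) by (intro less.hyps) auto
      moreover have "a * real (length r) \<le> awalk_cost f r"
        using d(3) Cons d(1) by (intro less.hyps) auto
      ultimately show ?thesis using Cons d(1) by (simp add: algebra_simps)
    qed
  qed simp
qed

text \<open>Every closed piece that is cut out pays at least \<open>a\<close> per arc. The path left
  at the end has fewer arcs than there are vertices, so the bound for it is at most 0 and
  nonnegative costs suffice.\<close>

lemma (in fin_digraph) awalk_cost_ge:
  assumes cyc: "\<And>c. cycle c \<Longrightarrow> a * real (length c) \<le> awalk_cost f c"
    and f: "\<And>e. 0 \<le> f e" and a: "0 \<le> a"
    and "awalk u p v"
  shows "a * (real (length p) - real (card (verts G))) \<le> awalk_cost f p"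
  using assms(4)
proof (induction "length p" arbitrary: p rule: less_induct)
  case less
  show ?case
  proof (cases "distinct (awalk_verts u p)")
    case True
    then have "apath u p v" using less.prems by (simp add: apath_def)
    then have "length p < card (verts G)" by (rule length_apath_less)
    then have "a * (real (length p) - real (card (verts G))) \<le> 0"
      using a by (intro mult_nonneg_nonpos) auto
    then show ?thesis using awalk_cost_nonneg[of f p, OF f] by linarith
  next
    case False
    obtain q r t w where d: "p = q @ r @ t" "awalk u q w" "awalk w r w" "awalk w t v" "closed_w r"
      using awalk_cyc_decompE'[OF less.prems False] by metis
    have r: "0 < length r" using d(5) by (auto simp: closed_w_def)
    have "awalk u (q @ t) v" using d by auto
    then have "a * (real (length (q @ t)) - real (card (verts G))) \<le> awalk_cost f (q @ t)"
      using r d(1) by (intro less.hyps) auto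
    moreover have "a * real (length r) \<le> awalk_cost f r"
      using closed_awalk_cost_ge[OF cyc d(3)] by simp
    ultimately show ?thesis using d(1) by (simp add: algebra_simps)
  qed
qed

lemma cas_nth:
  assumes "cas u p v" "p \<noteq> []"
  shows "tail G (p ! 0) = u" "head G (p ! (length p - 1)) = v"
    "Suc i < length p \<Longrightarrow> tail G (p ! Suc i) = head G (p ! i)"
proof -
  show "tail G (p ! 0) = u" using assms by (cases p) auto
  show "head G (p ! (length p - 1)) = v" using assms
  proof (induction p arbitrary: u)
    case (Cons e p) then show ?case by (cases p) auto
  qed simp
  show "tail G (p ! Suc i) = head G (p ! i)" if "Suc i < length p" using assms that
  proof (induction p arbitrary: u i)
    case (Cons e p) then show ?case by (cases p; cases i) auto
  qed simp
qed

end

section \<open>Densities of periodic covers\<close>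

lemma has_period_add_iff:
  assumes "has_period T l"
  shows "x + int (q * l) \<in> T \<longleftrightarrow> x \<in> T"
proof -
  have one: "x + int l \<in> T \<longleftrightarrow> x \<in> T" for x
  proof
    assume "x + int l \<in> T"
    then have "x + int l \<in> T + {int l}" using assms by (simp add: has_period_def)
    then show "x \<in> T" by (auto simp: set_plus_def)
  next
    assume "x \<in> T"
    then have "x + int l \<in> T + {int l}" by (intro set_plus_intro) auto
    then show "x + int l \<in> T" using assms by (simp add: has_period_def)
  qed
  show ?thesis
  proof (induction q)
    case (Suc q)
    then show ?case using one[of "x + int (q * l)"] by (simp add: algebra_simps)
  qed simp
qed

lemma card_periodic_le:
  assumes "has_period T l"
  shows "card (T \<inter> {0..<int (q * l)}) \<le> q * card (T \<inter> {0..<int l})"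
proof (induction q)
  case (Suc q)
  have "T \<inter> {0..<int (Suc q * l)}
      \<subseteq> (T \<inter> {0..<int (q * l)}) \<union> (\<lambda>x. x + int (q * l)) ` (T \<inter> {0..<int l})"
  proof
    fix x assume x: "x \<in> T \<inter> {0..<int (Suc q * l)}"
    show "x \<in> (T \<inter> {0..<int (q * l)}) \<union> (\<lambda>x. x + int (q * l)) ` (T \<inter> {0..<int l})"
    proof (cases "x < int (q * l)")
      case False
      have "x - int (q * l) \<in> T"
        using x has_period_add_iff[OF assms, of "x - int (q * l)" q] by simp
      then have "x - int (q * l) \<in> T \<inter> {0..<int l}" using x False by (simp add: algebra_simps)
      then show ?thesis by (intro UnI2 image_eqI[of _ _ "x - int (q * l)"]) auto
    qed (use x in auto)
  qed
  then have "card (T \<inter> {0..<int (Suc q * l)})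
      \<le> card ((T \<inter> {0..<int (q * l)}) \<union> (\<lambda>x. x + int (q * l)) ` (T \<inter> {0..<int l}))"
    by (intro card_mono) auto
  also have "\<dots> \<le> card (T \<inter> {0..<int (q * l)}) + card ((\<lambda>x. x + int (q * l)) ` (T \<inter> {0..<int l}))"
    by (rule card_Un_le)
  also have "card ((\<lambda>x. x + int (q * l)) ` (T \<inter> {0..<int l})) = card (T \<inter> {0..<int l})"
    by (intro card_image) (auto simp: inj_on_def)
  finally show ?case using Suc by simp
qed simp

lemma period_density_altdef: "period_density T l = real (card (T \<inter> {0..<int l})) / real l"
proof -
  have "{0..int l - 1} = {0..<int l}" by auto
  then show ?thesis by (simp add: period_density_def)
qed

text \<open>A periodic cover, cut down to what can reach \<open>{1..q * l}\<close>, uses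
  \<open>q\<close> periods and a number of extra points bounded independently of \<open>q\<close>.
  These vanish after division by \<open>q * l\<close>.\<close>

lemma cover_density_le_period_density:
  assumes S: "S \<subseteq> {0..int s}" "S \<noteq> {}" and per: "has_period T l" and cov: "T + S = UNIV"
  shows "cover_density S \<le> period_density T l"
proof -
  define w where "w = card (T \<inter> {0..<int l})"
  have l: "0 < l" using per by (simp add: has_period_def)
  have le: "cover_num S (q * l) \<le> s + 1 + q * w" for q
  proof -
    \<comment> \<open>Elements of \<open>S\<close> lie between 0 and \<open>s\<close>, so only these
      elements of \<open>T\<close> can cover a point of \<open>{1..int (q * l)}\<close>.\<close>
    let ?U = "T \<inter> {1 - int s..int (q * l)}"
    have "{1..int (q * l)} \<subseteq> ?U + S"
    proof
      fix x assume x: "x \<in> {1..int (q * l)}"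
      have "x \<in> T + S" using cov by simp
      then obtain t y where ty: "t \<in> T" "y \<in> S" "x = t + y" by (auto simp: set_plus_def)
      have "y \<in> {0..int s}" using ty S by blast
      then have "t \<in> ?U" using ty x by auto
      then show "x \<in> ?U + S" using ty by (auto simp: set_plus_def)
    qed
    then have "cover_num S (q * l) \<le> card ?U" by (intro cover_num_le) auto
    \<comment> \<open>The range is compared with the \<open>q\<close> full periods in
      \<open>{0..<int (q * l)}\<close>; at most \<open>s + 1\<close> boundary points stick
      out.\<close>
    also have "\<dots> \<le> card (({1 - int s..0} \<union> {int (q * l)}) \<union> (T \<inter> {0..<int (q * l)}))"
      by (intro card_mono) auto
    also have "\<dots> \<le> card ({1 - int s..0} \<union> {int (q * l)}) + card (T \<inter> {0..<int (q * l)})"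
      by (rule card_Un_le)
    also have "\<dots> \<le> (s + 1) + q * w"
    proof (rule add_mono)
      show "card ({1 - int s..0} \<union> {int (q * l)}) \<le> s + 1"
        using card_Un_le[of "{1 - int s..0}" "{int (q * l)}"] by simp
      show "card (T \<inter> {0..<int (q * l)}) \<le> q * w"
        unfolding w_def by (rule card_periodic_le[OF per])
    qed
    finally show ?thesis .
  qed
  have "(\<lambda>q. real (cover_num S (q * l)) / real (q * l)) \<longlonglongrightarrow> cover_density S"
  proof -
    have "strict_mono (\<lambda>q. q * l)" using l by (auto simp: strict_mono_def)
    from LIMSEQ_subseq_LIMSEQ[OF cover_density_LIMSEQ(1)[OF S(2)] this]
    show ?thesis by (simp add: o_def)
  qed
  moreover have "(\<lambda>q. (real s + 1) / real l / real q + real w / real l)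
      \<longlonglongrightarrow> 0 + real w / real l"
    by (intro tendsto_add tendsto_const lim_const_over_n)
  moreover have "\<exists>N. \<forall>q\<ge>N. real (cover_num S (q * l)) / real (q * l)
      \<le> (real s + 1) / real l / real q + real w / real l"
  proof (intro exI[of _ 1] allI impI)
    fix q :: nat assume q: "1 \<le> q"
    have "real (cover_num S (q * l)) \<le> real (s + 1 + q * w)" using le[of q] by (simp only: of_nat_le_iff)
    then have "real (cover_num S (q * l)) / real (q * l) \<le> real (s + 1 + q * w) / real (q * l)"
      by (intro divide_right_mono) auto
    also have "\<dots> = (real s + 1) / real l / real q + real w / real l"
      using q l by (simp add: field_simps)
    finally show "real (cover_num S (q * l)) / real (q * l)
      \<le> (real s + 1) / real l / real q + real w / real l" .
  qed
  ultimately have "cover_density S \<le> 0 + real w / real l" by (rule LIMSEQ_le)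
  then show ?thesis by (simp add: period_density_altdef w_def)
qed

section \<open>From cycles to periodic covers\<close>

lemma mem_shift_iff: "j \<in> shift A \<longleftrightarrow> j + 1 \<in> A"
  unfolding shift_def by force

text \<open>For the last equivalence: shifting a subset of \<open>{1..int s}\<close> vacates
  position \<open>s\<close>, and only an arc of weight 1 fills it again. Together with the shift
  rule, this makes a vertex a record of the last \<open>s\<close> weights.\<close>

lemma cover_graph_arcsD:
  assumes "e \<in> arcs (cover_graph s S)"
  shows "fst e \<subseteq> {1..int s}" "fst (snd e) \<in> {0, 1}"
    "fst (snd e) = 0 \<Longrightarrow> int s + 1 \<in> fst e + S"
    "1 \<le> j \<Longrightarrow> j < int s \<Longrightarrow> j \<in> snd (snd e) \<longleftrightarrow> j + 1 \<in> fst e"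
    "1 \<le> s \<Longrightarrow> int s \<in> snd (snd e) \<longleftrightarrow> fst (snd e) = 1"
  using assms by (auto simp: cover_graph_def mem_shift_iff)

lemma periodic_cover_of_cycle:
  assumes s: "s \<ge> 1" and zero: "0 \<in> S" and cyc: "pre_digraph.cycle (cover_graph s S) c"
  shows "\<exists>T. has_period T (length c) \<and> T + S = UNIV \<and>
    period_density T (length c) = wf_digraph.awalk_cost arc_weight c / real (length c)"
proof -
  interpret fin_digraph "cover_graph s S" using s by (rule fin_digraph_cover_graph)
  define l where "l = length c"
  \<comment> \<open>Reduction modulo \<open>l\<close> repeats the cycle in both directions, negative
    positions included, so \<open>T\<close> is defined on all integers.\<close>
  define e where "e x = c ! nat (x mod int l)" for x
  define T where "T = {x. fst (snd (e x)) = 1}"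
  obtain u where u: "awalk u c u" "c \<noteq> []" using cyc by (auto simp: cycle_def)
  have cas: "cas u c u" using u(1) by auto
  have l: "0 < l" using u(2) by (simp add: l_def)
  have idx: "nat (x mod int l) < l" for x
    using l pos_mod_bound[of "int l" x] pos_mod_sign[of "int l" x] by linarith
  have arc: "e x \<in> arcs (cover_graph s S)" for x
    using u(1) idx[of x] unfolding e_def l_def by (metis awalkE' nth_mem subsetD)
  have step: "fst (e (x + 1)) = snd (snd (e x))" for x
  proof -
    define i where "i = nat (x mod int l)"
    have i: "x mod int l = int i" "i < l"
      using idx[of x] l pos_mod_sign[of "int l" x] by (auto simp: i_def)
    have next_mod: "(x + 1) mod int l = (int i + 1) mod int l"
      by (metis i(1) mod_add_left_eq)
    have "tail (cover_graph s S) (e (x + 1)) = head (cover_graph s S) (e x)"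
    \<comment> \<open>Inside the cycle consecutive arcs match. At \<open>i = l - 1\<close> the index
      wraps to 0, and the match comes from the walk being closed.\<close>
    proof (cases "Suc i < l")
      case True
      have "(x + 1) mod int l = int (Suc i)" using next_mod True by simp
      then have "nat ((x + 1) mod int l) = Suc i" by linarith
      then show ?thesis using cas_nth(3)[OF cas u(2), of i] True i(1) by (simp add: e_def l_def)
    next
      case False
      then have last: "i = l - 1" using i(2) by simp
      have "(x + 1) mod int l = 0" using next_mod last l by (simp add: of_nat_diff)
      then show ?thesis using cas_nth(1,2)[OF cas u(2)] i(1) last by (simp add: e_def l_def)
    qed
    then show ?thesis by (simp add: cover_graph_def)
  qed
  \<comment> \<open>A bit enters at position \<open>s\<close> and moves down by one with each arc,
    so position \<open>s - k\<close> was written \<open>k + 1\<close> arcs earlier. As the sequence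
    has an infinite past, the whole tail of \<open>e x\<close> is determined by
    \<open>T\<close>.\<close>
  have window: "k < s \<Longrightarrow> int (s - k) \<in> fst (e x) \<longleftrightarrow> x - 1 - int k \<in> T" for x k
  proof (induction k arbitrary: x)
    case 0
    have "int s \<in> fst (e x) \<longleftrightarrow> fst (snd (e (x - 1))) = 1"
      using cover_graph_arcsD(5)[OF arc[of "x - 1"] s] step[of "x - 1"] by simp
    then show ?case by (simp add: T_def)
  next
    case (Suc k)
    have "int (s - Suc k) \<in> fst (e x) \<longleftrightarrow> int (s - Suc k) + 1 \<in> fst (e (x - 1))"
      using cover_graph_arcsD(4)[OF arc[of "x - 1"], of "int (s - Suc k)"] step[of "x - 1"] Suc.prems
      by simp
    also have "int (s - Suc k) + 1 = int (s - k)" using Suc.prems by linarith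
    also have "\<dots> \<in> fst (e (x - 1)) \<longleftrightarrow> x - 1 - 1 - int k \<in> T" using Suc by simp
    finally show ?case by (simp add: algebra_simps)
  qed
  have "x \<in> T + S" for x
  proof (cases "x \<in> T")
    case True
    then have "x + 0 \<in> T + S" using zero by (intro set_plus_intro)
    then show ?thesis by simp
  next
    case False
    then have "fst (snd (e x)) = 0" using cover_graph_arcsD(2)[OF arc[of x]] by (auto simp: T_def)
    then have "int s + 1 \<in> fst (e x) + S" by (rule cover_graph_arcsD(3)[OF arc])
    then obtain j y where jy: "j \<in> fst (e x)" "y \<in> S" "int s + 1 = j + y"
      by (auto simp: set_plus_def)
    have j: "1 \<le> j" "j \<le> int s" using cover_graph_arcsD(1)[OF arc[of x]] jy(1) by auto
    \<comment> \<open>Position \<open>j\<close> in the tail of \<open>e x\<close> stands for the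
      integer \<open>x - (int s + 1) + j\<close>, which is \<open>x - y\<close> because
      \<open>int s + 1 = j + y\<close>.\<close>
    define k where "k = nat (int s - j)"
    have k: "k < s" "j = int (s - k)" "x - 1 - int k = x - y" using j jy(3) by (auto simp: k_def)
    then have "x - y \<in> T" using window[OF k(1), of x] jy(1) by (simp only: k(2,3))
    then have "(x - y) + y \<in> T + S" using jy(2) by (intro set_plus_intro)
    then show ?thesis by simp
  qed
  then have cov: "T + S = UNIV" by blast
  have inv: "x + int l \<in> T \<longleftrightarrow> x \<in> T" for x by (simp add: T_def e_def)
  have "T + {int l} = T"
  proof (intro set_eqI)
    fix x
    have "x \<in> T + {int l} \<longleftrightarrow> x - int l \<in> T"
    proof -
      have "x - int l \<in> T \<Longrightarrow> (x - int l) + int l \<in> T + {int l}" by (intro set_plus_intro) auto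
      then show ?thesis by (auto simp: set_plus_def)
    qed
    then show "x \<in> T + {int l} \<longleftrightarrow> x \<in> T" using inv[of "x - int l"] by simp
  qed
  then have per: "has_period T l" using l by (simp add: has_period_def)
  have "awalk_cost arc_weight c = (\<Sum>i<l. arc_weight (c ! i))"
    unfolding awalk_cost_def l_def by (simp add: sum_list_sum_nth atLeast0LessThan)
  also have "\<dots> = (\<Sum>i<l. if int i \<in> T then 1 else 0)"
  proof (intro sum.cong refl)
    fix i assume "i \<in> {..<l}"
    then have "e (int i) = c ! i" by (simp add: e_def)
    then show "arc_weight (c ! i) = (if int i \<in> T then 1 else 0)"
      using cover_graph_arcsD(2)[OF arc[of "int i"]] by (auto simp: arc_weight_def T_def)
  qed
  also have "\<dots> = real (card {i. i < l \<and> int i \<in> T})"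
    by (simp add: sum.If_cases Collect_conj_eq lessThan_def)
  also have "card {i. i < l \<and> int i \<in> T} = card (int ` {i. i < l \<and> int i \<in> T})"
    by (intro card_image[symmetric]) simp
  also have "int ` {i. i < l \<and> int i \<in> T} = T \<inter> {0..<int l}"
  proof (intro set_eqI iffI)
    fix x assume x: "x \<in> T \<inter> {0..<int l}"
    then show "x \<in> int ` {i. i < l \<and> int i \<in> T}" by (intro image_eqI[of _ _ "nat x"]) auto
  qed auto
  finally have "period_density T l = awalk_cost arc_weight c / real l"
    by (simp add: period_density_altdef)
  then show ?thesis using per cov unfolding l_def by blast
qed

section \<open>From covers to walks\<close>

text \<open>The part of \<open>T\<close> in the \<open>s\<close> integers before \<open>x\<close>,
  moved into \<open>{1..int s}\<close>. Under this translation \<open>x\<close> itself becomes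
  \<open>int s + 1\<close>, the point that an arc of weight 0 requires to be covered.\<close>

definition window :: "nat \<Rightarrow> int set \<Rightarrow> int \<Rightarrow> int set" where
  "window s T x = {j \<in> {1..int s}. x - (int s + 1) + j \<in> T}"

definition window_arc :: "nat \<Rightarrow> int set \<Rightarrow> int \<Rightarrow> cover_arc" where
  "window_arc s T x = (window s T x, if x \<in> T then 1 else 0, window s T (x + 1))"

lemma window_arc_in_arcs:
  assumes s: "s \<ge> 1" and S: "S \<subseteq> {0..int s}" and x: "x \<in> T + S"
  shows "window_arc s T x \<in> arcs (cover_graph s S)"
proof -
  have sub: "window s T x \<in> Pow {1..int s}" by (auto simp: window_def)
  have Suc_window: "window s T (x + 1) = (shift (window s T x) - {0}) \<union> (if x \<in> T then {int s} else {})"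
  proof (rule set_eqI)
    fix j
    show "j \<in> window s T (x + 1) \<longleftrightarrow>
        j \<in> (shift (window s T x) - {0}) \<union> (if x \<in> T then {int s} else {})"
    proof (cases "j = int s")
      case True
      then show ?thesis using s by (auto simp: window_def mem_shift_iff)
    next
      case False
      then show ?thesis by (auto simp: window_def mem_shift_iff algebra_simps)
    qed
  qed
  show ?thesis
  proof (cases "x \<in> T")
    case True
    then show ?thesis using sub Suc_window by (simp add: window_arc_def cover_graph_def)
  next
    case False
    obtain t y where ty: "t \<in> T" "y \<in> S" "x = t + y" using x by (auto simp: set_plus_def)
    have y: "0 \<le> y" "y \<le> int s" using ty(2) S by auto
    \<comment> \<open>Since \<open>x\<close> is not in \<open>T\<close>, the element
      \<open>t\<close> covering it is one of the \<open>s\<close> integers before \<open>x\<close>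
      and is therefore visible in the window.\<close>
    have "y \<noteq> 0" using ty False by auto
    then have "int s + 1 - y \<in> window s T x" using ty y by (auto simp: window_def)
    then have "(int s + 1 - y) + y \<in> window s T x + S" using ty(2) by (intro set_plus_intro)
    then have "int s + 1 \<in> window s T x + S" by simp
    then show ?thesis using sub Suc_window False by (simp add: window_arc_def cover_graph_def)
  qed
qed

lemma window_walk:
  assumes s: "s \<ge> 1" and S: "S \<subseteq> {0..int s}" and cov: "{1..int n} \<subseteq> T + S"
  shows "pre_digraph.awalk (cover_graph s S) (window s T 1)
    (map (\<lambda>i. window_arc s T (int i + 1)) [0..<n]) (window s T (int n + 1))"
proof -
  interpret fin_digraph "cover_graph s S" using s by (rule fin_digraph_cover_graph)
  show ?thesis using cov
  proof (induction n)
    case 0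
    have "window s T 1 \<in> verts (cover_graph s S)" by (auto simp: cover_graph_def window_def)
    then show ?case by (simp add: awalk_Nil_iff)
  next
    case (Suc n)
    have "int n + 1 \<in> {1..int (Suc n)}" by simp
    then have "window_arc s T (int n + 1) \<in> arcs (cover_graph s S)"
      using Suc.prems by (intro window_arc_in_arcs[OF s S]) blast
    then have "awalk (window s T (int n + 1)) [window_arc s T (int n + 1)] (window s T (int n + 1 + 1))"
      using head_in_verts[of "window_arc s T (int n + 1)"]
      by (simp add: awalk_Cons_iff awalk_Nil_iff) (simp add: cover_graph_def window_arc_def)
    moreover have "awalk (window s T 1) (map (\<lambda>i. window_arc s T (int i + 1)) [0..<n])
        (window s T (int n + 1))"
      using Suc.prems by (intro Suc.IH) auto
    ultimately show ?case by (simp add: add.commute)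
  qed
qed

text \<open>Only elements of \<open>T\<close> in \<open>{1..int n}\<close> are paid for; those just
  before 1 enter free of charge through the starting vertex, hence an inequality.\<close>

lemma window_walk_cost_le:
  assumes "finite T"
  shows "wf_digraph.awalk_cost arc_weight (map (\<lambda>i. window_arc s T (int i + 1)) [0..<n])
    \<le> real (card T)"
proof -
  \<comment> \<open>The cost of a walk does not depend on the graph, so any well-formed digraph will do.\<close>
  interpret wf_digraph "cover_graph 1 {}"
    using fin_digraph_cover_graph[of 1 "{}"] by (simp add: fin_digraph_def)
  have "awalk_cost arc_weight (map (\<lambda>i. window_arc s T (int i + 1)) [0..<n])
      = real (card (T \<inter> {1..int n}))"
  proof (induction n)
    case (Suc n)
    have "{1..int (Suc n)} = insert (int n + 1) {1..int n}" by auto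
    then show ?case using Suc by (simp add: arc_weight_def window_arc_def Int_insert_right)
  qed simp
  also have "\<dots> \<le> real (card T)" using assms by (simp add: card_mono)
  finally show ?thesis .
qed

section \<open>The lower bound for the covering density, and the combination of both bounds\<close>

lemma cover_density_ge:
  assumes s: "s \<ge> 1" and S: "S \<subseteq> {0..int s}" "S \<noteq> {}" and a: "0 \<le> a"
    and le: "\<And>m. m \<in> cycle_means s S \<Longrightarrow> a \<le> m"
  shows "a \<le> cover_density S"
proof -
  interpret fin_digraph "cover_graph s S" using s by (rule fin_digraph_cover_graph)
  define V where "V = real (card (verts (cover_graph s S)))"
  have cyc: "a * real (length c) \<le> awalk_cost arc_weight c" if "cycle c" for c
  proof -
    have "a \<le> awalk_cost arc_weight c / real (length c)"
      using that by (intro le) (auto simp: cycle_means_def)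
    moreover have "0 < length c" using that by (auto simp: cycle_def)
    ultimately show ?thesis by (simp add: field_simps)
  qed
  have ge: "a * (real n - V) \<le> real (cover_num S n)" for n
  proof -
    obtain T where T: "finite T" "card T = cover_num S n" "{1..int n} \<subseteq> T + S"
      using cover_num_attained[OF S(2)] by blast
    have "a * (real (length (map (\<lambda>i. window_arc s T (int i + 1)) [0..<n])) - V)
        \<le> awalk_cost arc_weight (map (\<lambda>i. window_arc s T (int i + 1)) [0..<n])"
      unfolding V_def using window_walk[OF s S(1) T(3)] cyc a
      by (intro awalk_cost_ge) (auto simp: arc_weight_def)
    also have "\<dots> \<le> real (cover_num S n)" using window_walk_cost_le[OF T(1)] T(2) by simp
    finally show ?thesis by simp
  qed
  \<comment> \<open>The loss \<open>a * V\<close> does not depend on \<open>n\<close>, so it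
    disappears from the quotient in the limit.\<close>
  have "(\<lambda>n. a - a * V / real n) \<longlonglongrightarrow> a - 0"
    by (intro tendsto_diff tendsto_const lim_const_over_n)
  moreover have "\<exists>N. \<forall>n\<ge>N. a - a * V / real n \<le> real (cover_num S n) / real n"
  proof (intro exI[of _ 1] allI impI)
    fix n :: nat assume n: "1 \<le> n"
    have "a - a * V / real n = a * (real n - V) / real n" using n by (simp add: field_simps)
    also have "\<dots> \<le> real (cover_num S n) / real n" using ge by (intro divide_right_mono) auto
    finally show "a - a * V / real n \<le> real (cover_num S n) / real n" .
  qed
  ultimately have "a - 0 \<le> cover_density S"
    using cover_density_LIMSEQ(1)[OF S(2)] by (intro LIMSEQ_le)
  then show ?thesis by simp
qed

theorem theorem5p1:
  fixes s :: nat and S :: "int set"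
  assumes "s \<ge> 1" and "S \<subseteq> {0..int s}" and "0 \<in> S"
  shows "cover_density S = min_cycle_mean s S
    \<and> (\<exists>T l. has_period T l \<and> T + S = UNIV \<and> period_density T l = cover_density S)
    \<and> cover_density S \<in> \<rat>"
proof -
  interpret fin_digraph "cover_graph s S" using assms(1) by (rule fin_digraph_cover_graph)
  have ne: "S \<noteq> {}" using assms(3) by blast
  have "min_cycle_mean s S \<in> cycle_means s S"
    unfolding min_cycle_mean_def
    using finite_cycle_means cycle_means_nonempty assms(1) by (intro Min_in) auto
  then obtain c where c: "cycle c" "min_cycle_mean s S = awalk_cost arc_weight c / real (length c)"
    by (auto simp: cycle_means_def)
  \<comment> \<open>This single cover, unrolled from an optimal cycle, gives the upper bound and
    attains the density. Since \<alpha> is its density, a quotient of natural numbers, \<alpha> is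
    also nonnegative, as the lower bound requires, and rational.\<close>
  obtain T where T: "has_period T (length c)" "T + S = UNIV"
      "period_density T (length c) = min_cycle_mean s S"
    using periodic_cover_of_cycle[OF assms(1,3) c(1)] c(2) by auto
  have "cover_density S \<le> min_cycle_mean s S"
    using cover_density_le_period_density[OF assms(2) ne T(1,2)] T(3) by simp
  moreover have "min_cycle_mean s S \<le> cover_density S"
  proof (rule cover_density_ge[OF assms(1,2) ne])
    show "0 \<le> min_cycle_mean s S" using T(3) by (simp add: period_density_def flip: T(3))
    show "min_cycle_mean s S \<le> m" if "m \<in> cycle_means s S" for m
      unfolding min_cycle_mean_def using that finite_cycle_means[OF assms(1)] by (intro Min_le)
  qed
  ultimately have eq: "cover_density S = min_cycle_mean s S" by simp
  have "min_cycle_mean s S \<in> \<rat>" unfolding T(3)[symmetric] period_density_def by simp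
  then show ?thesis using eq T by metis
qed

end
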